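(* Let $\Theta=\{\langle \mu,\nu\rangle\in[0,1]^2 \mid \mu+\nu\le 1\}$ and, for $\alpha=\langle\mu_\alpha,\nu_\alpha\rangle$, $\beta=\langle\mu_\beta,\nu_\beta\rangle\in\Theta$, let $$\overline{JS}_{\mathrm{IF}}(\alpha,\beta)=\sqrt{\tfrac12\big(L(1-\mu_\alpha,1-\mu_\beta)+L(\nu_\alpha,\nu_\beta)\big)},\qquad L(p,q)=p\log_2\frac{2p}{p+q}+q\log_2\frac{2q}{p+q}.$$ Then: (1) $\overline{JS}_{\mathrm{IF}}$ is a strict intuitionistic fuzzy distance measure (SIFDisM) on $\Theta$. (2) The function $\mathbf{S}_{\mathrm{IF}}(\alpha,\beta)=1-\overline{JS}_{\mathrm{IF}}(\alpha,\beta)$ is a strict intuitionistic fuzzy similarity measure (SIFSimM) on $\Theta$.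
   Context: Convention: in $L(p,q)$ ($p,q\ge 0$), any term whose leading factor is $0$ equals $0$ (including $0\cdot\log_2 0=0\cdot\log_2\frac{0}{0+0}=0$). Order on $\Theta$: $\alpha\subset\beta$ iff $\mu_\alpha\le\mu_\beta$ and $\nu_\alpha\ge\nu_\beta$; $\alpha\subsetneqq\beta$ iff $\alpha\subset\beta$ and $\alpha\ne\beta$. A map $\mathbf{S}:\Theta\times\Theta\to[0,1]$ is a SIFSimM on $\Theta$ if for all $\alpha_1,\alpha_2,\alpha_3\in\Theta$: (S1) $0\le\mathbf{S}(\alpha_1,\alpha_2)\le1$; (S2) $\mathbf{S}(\alpha_1,\alpha_2)=1$ iff $\alpha_1=\alpha_2$; (S3) $\mathbf{S}(\alpha_1,\alpha_2)=\mathbf{S}(\alpha_2,\alpha_1)$; (S4$'$) if $\alpha_1\subsetneqq\alpha_2\subsetneqq\alpha_3$, then $\mathbf{S}(\alpha_1,\alpha_3)<\mathbf{S}(\alpha_1,\alpha_2)$ and $\mathbf{S}(\alpha_1,\alpha_3)<\mathbf{S}(\alpha_2,\alpha_3)$; (S5) $\mathbf{S}(\alpha_1,\alpha_2)=0$ iff ($\alpha_1=\langle0,1\rangle$ and $\alpha_2=\langle1,0\rangle$) or ($\alpha_1=\langle1,0\rangle$ and $\alpha_2=\langle0,1\rangle$). A map $d:\Theta\times\Theta\to[0,1]$ is a SIFDisM on $\Theta$ if (D1) $d$ is a distance (metric) on $\Theta$: nonnegative, $d(\alpha,\beta)=0$ iff $\alpha=\beta$, symmetric, and satisfying the triangle inequality;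 and (D2) $1-d$ is a SIFSimM on $\Theta$. *)

theory Defs
  imports "HOL-Analysis.Analysis"
begin

typedef ifv = "{(m::real, n::real). m \<in> {0..1} \<and> n \<in> {0..1} \<and> m + n \<le> 1}"
  morphisms pair_of_ifv Ifv
proof
  show "(0, 0) \<in> {(m::real, n::real). m \<in> {0..1} \<and> n \<in> {0..1} \<and> m + n \<le> 1}"
    by simp
qed

definition membership :: "ifv \<Rightarrow> real" where
  "membership a = fst (pair_of_ifv a)"

definition nonmembership :: "ifv \<Rightarrow> real" where
  "nonmembership a = snd (pair_of_ifv a)"

definition ifv_subset :: "ifv \<Rightarrow> ifv \<Rightarrow> bool" where
  "ifv_subset a b \<longleftrightarrow> membership a \<le> membership b \<and> nonmembership a \<ge> nonmembership b"

definition ifv_psubset :: "ifv \<Rightarrow> ifv \<Rightarrow> bool" where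
  "ifv_psubset a b \<longleftrightarrow> ifv_subset a b \<and> a \<noteq> b"

definition SIFSimM :: "(ifv \<Rightarrow> ifv \<Rightarrow> real) \<Rightarrow> bool" where
  "SIFSimM S \<longleftrightarrow>
     (\<forall>a b. 0 \<le> S a b \<and> S a b \<le> 1) \<and>
     (\<forall>a b. S a b = 1 \<longleftrightarrow> a = b) \<and>
     (\<forall>a b. S a b = S b a) \<and>
     (\<forall>a b c. ifv_psubset a b \<and> ifv_psubset b c \<longrightarrow> S a c < S a b \<and> S a c < S b c) \<and>
     (\<forall>a b. S a b = 0 \<longleftrightarrow>
        a = Ifv (0, 1) \<and> b = Ifv (1, 0) \<or> a = Ifv (1, 0) \<and> b = Ifv (0, 1))"

definition SIFDisM :: "(ifv \<Rightarrow> ifv \<Rightarrow> real) \<Rightarrow> bool" where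
  "SIFDisM d \<longleftrightarrow>
     (\<forall>a b. d a b \<in> {0..1}) \<and>
     Metric_space UNIV d \<and>
     SIFSimM (\<lambda>a b. 1 - d a b)"

text \<open>
  For \<open>p, q \<ge> 0\<close>, a summand whose leading factor is zero vanishes,
  since \<open>0 * x = 0\<close> for whatever value the total functions \<open>log\<close> and \<open>/\<close> return;
  this gives the usual convention \<open>0 * log 2 0 = 0 * log 2 (0 / (0 + 0)) = 0\<close>.
\<close>

definition JS_term :: "real \<Rightarrow> real \<Rightarrow> real" where
  "JS_term p q = p * log 2 (2 * p / (p + q)) + q * log 2 (2 * q / (p + q))"

definition JS_IF :: "ifv \<Rightarrow> ifv \<Rightarrow> real" where
  "JS_IF a b = sqrt (1 / 2 *
     (JS_term (1 - membership a) (1 - membership b) + JS_term (nonmembership a) (nonmembership b)))"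

definition S_IF :: "ifv \<Rightarrow> ifv \<Rightarrow> real" where
  "S_IF a b = 1 - JS_IF a b"

end

theory Submission
  imports Defs "HOL-Real_Asymp.Real_Asymp"
begin

text \<open>
  Up to the factor \<open>1 / ln 2\<close>, \<open>L p q\<close> is \<open>jsn p q\<close> below, which strictly increases as the interval
  between \<open>p\<close> and \<open>q\<close> grows; this yields the order axioms and the extremal cases.

  For the triangle inequality it suffices, by optimising over \<open>s > 0\<close>, that
  \<open>jsn p r \<le> (1 + s) * jsn p q + (1 + 1 / s) * jsn q r\<close>. This form is linear in \<open>jsn\<close>, so it passes
  to the sum of the two components. Shift all arguments by \<open>u > 0\<close>: the difference of the two
  sides and its derivative in \<open>u\<close> tend to \<open>0\<close> at infinity, and its second derivative is a
  quadratic form in the Cauchy matrix \<open>1 / (x\<^sub>i + x\<^sub>j)\<close>, hence nonnegative. So the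
  difference is convex and vanishes at infinity, and therefore it is nonnegative.
\<close>

section \<open>Jensen-Shannon terms: continuity, monotonicity and extremal values\<close>

lemma continuous_on_x_ln_x: "continuous_on {0..} (\<lambda>x::real. x * ln x)"
  unfolding continuous_on_def
proof
  fix x :: real
  assume x: "x \<in> {0..}"
  show "((\<lambda>x. x * ln x) \<longlongrightarrow> x * ln x) (at x within {0..})"
  proof (cases "x = 0")
    case True
    have "((\<lambda>x::real. x * ln x) \<longlongrightarrow> 0) (at_right 0)"
      by real_asymp
    then have "((\<lambda>x::real. x * ln x) \<longlongrightarrow> 0) (at 0 within {0..})"
      by (simp add: at_within_Ici_at_right)
    then show ?thesis using True by simp
  next
    case False
    with x show ?thesis by (intro tendsto_intros) auto
  qed
qed

text \<open>Expanding the logarithms leaves only multiples of \<open>x * ln x\<close> and linear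
  terms, which are continuous up to 0.\<close>

definition jsn :: "real \<Rightarrow> real \<Rightarrow> real" where
  "jsn p q = p * ln p + q * ln q - (p + q) * ln (p + q) + (p + q) * ln 2"

lemma JS_term_eq_jsn:
  assumes "0 \<le> p" "0 \<le> q"
  shows "JS_term p q = jsn p q / ln 2"
proof -
  consider "p = 0" "q = 0" | "p = 0" "q > 0" | "p > 0" "q = 0" | "p > 0" "q > 0"
    using assms by linarith
  then show ?thesis
    by cases (simp_all add: JS_term_def jsn_def log_def ln_mult ln_div field_simps)
qed

lemma jsn_commute: "jsn p q = jsn q p"
  by (simp add: jsn_def algebra_simps)

lemma jsn_self [simp]: "p \<ge> 0 \<Longrightarrow> jsn p p = 0"
  by (cases "p = 0") (simp_all add: jsn_def ln_mult algebra_simps flip: mult_2)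

lemma continuous_on_jsn [continuous_intros]:
  assumes "continuous_on S f" "continuous_on S g" "\<And>x. x \<in> S \<Longrightarrow> 0 \<le> f x" "\<And>x. x \<in> S \<Longrightarrow> 0 \<le> g x"
  shows "continuous_on S (\<lambda>x. jsn (f x) (g x))"
proof -
  have *: "continuous_on S (\<lambda>x. h x * ln (h x))"
    if "continuous_on S h" "\<And>x. x \<in> S \<Longrightarrow> 0 \<le> h x" for h :: "'a \<Rightarrow> real"
    using continuous_on_compose2[OF continuous_on_x_ln_x that(1)] that(2) by auto
  show ?thesis unfolding jsn_def
    by (intro continuous_intros * assms) (use assms(3,4) in \<open>auto intro: add_nonneg_nonneg\<close>)
qed

text \<open>The derivative in the second argument is \<open>ln (2 * x / (p + x))\<close>, positive
  once \<open>x > p\<close>. It is taken on the open interval only, since \<open>x * ln x\<close> is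
  not differentiable at 0; continuity covers the endpoints.\<close>

lemma jsn_strict_mono_right:
  assumes "0 \<le> p" "p \<le> q" "q < r"
  shows "jsn p q < jsn p r"
proof (rule DERIV_pos_imp_increasing_open[OF \<open>q < r\<close>])
  fix x assume x: "q < x" "x < r"
  have "((\<lambda>x. jsn p x) has_real_derivative ln x - ln (p + x) + ln 2) (at x)"
    unfolding jsn_def using x assms
    by (auto intro!: derivative_eq_intros simp: add_nonneg_eq_0_iff)
  moreover have "ln (p + x) < ln (2 * x)"
    using x assms by simp
  then have "ln x - ln (p + x) + ln 2 > 0"
    using x assms by (simp add: ln_mult)
  ultimately show "\<exists>y. ((\<lambda>x. jsn p x) has_real_derivative y) (at x) \<and> 0 < y"
    by blast
qed (use assms in \<open>auto intro!: continuous_intros\<close>)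

lemma jsn_strict_antimono_left:
  assumes "0 \<le> p" "p < q" "q \<le> r"
  shows "jsn q r < jsn p r"
proof (rule DERIV_neg_imp_decreasing_open[OF \<open>p < q\<close>])
  fix x assume x: "p < x" "x < q"
  have "((\<lambda>x. jsn x r) has_real_derivative ln x - ln (x + r) + ln 2) (at x)"
    unfolding jsn_def using x assms
    by (auto intro!: derivative_eq_intros simp: add_nonneg_eq_0_iff)
  moreover have "ln (2 * x) < ln (x + r)"
    using x assms by simp
  then have "ln x - ln (x + r) + ln 2 < 0"
    using x assms by (simp add: ln_mult)
  ultimately show "\<exists>y. ((\<lambda>x. jsn x r) has_real_derivative y) (at x) \<and> y < 0"
    by blast
qed (use assms in \<open>auto intro!: continuous_intros\<close>)

lemma jsn_pos:
  assumes "0 \<le> p" "0 \<le> q" "p \<noteq> q"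
  shows "0 < jsn p q"
  using jsn_strict_mono_right[of p p q] jsn_strict_mono_right[of q q p] assms
  by (cases "p < q") (auto simp: jsn_commute[of p q])

lemma jsn_nonneg: "0 \<le> p \<Longrightarrow> 0 \<le> q \<Longrightarrow> 0 \<le> jsn p q"
  using jsn_pos[of p q] by (cases "p = q") auto

lemma jsn_mono:
  assumes "0 \<le> p'" "p' \<le> p" "p \<le> q" "q \<le> q'"
  shows "jsn p q \<le> jsn p' q'"
  using jsn_strict_mono_right[of p q q'] jsn_strict_antimono_left[of p' p q'] assms
  by (cases "p' = p"; cases "q = q'") auto

lemma jsn_strict_mono:
  assumes "0 \<le> p'" "p' \<le> p" "p \<le> q" "q \<le> q'" "p' \<noteq> p \<or> q \<noteq> q'"
  shows "jsn p q < jsn p' q'"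
  using jsn_strict_mono_right[of p q q'] jsn_strict_antimono_left[of p' p q'] assms
  by (cases "p' = p"; cases "q = q'") auto

lemma jsn_le_ln2:
  assumes "p \<in> {0..1}" "q \<in> {0..1}"
  shows "jsn p q \<le> ln 2"
  using jsn_mono[of 0 p q 1] jsn_mono[of 0 q p 1] assms
  by (cases "p \<le> q") (auto simp: jsn_def[of 0 1] jsn_commute[of p q])

text \<open>By strict monotonicity, any interval properly inside \<open>{0..1}\<close> gives less
  than the value \<open>ln 2\<close> of the full one.\<close>

lemma jsn_eq_ln2_iff:
  assumes "p \<in> {0..1}" "q \<in> {0..1}"
  shows "jsn p q = ln 2 \<longleftrightarrow> p = 0 \<and> q = 1 \<or> p = 1 \<and> q = 0"
proof -
  have [simp]: "jsn 0 1 = ln 2" "jsn 1 0 = ln 2"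
    by (simp_all add: jsn_def)
  have *: "jsn p q = ln 2 \<longleftrightarrow> p = 0 \<and> q = 1" if "0 \<le> p" "p \<le> q" "q \<le> 1" for p q
    using jsn_strict_mono[of 0 p q 1] that by (cases "p = 0 \<and> q = 1") auto
  show ?thesis
  proof (cases "p \<le> q")
    case True
    then show ?thesis using *[of p q] assms by auto
  next
    case False
    then show ?thesis using *[of q p] assms unfolding jsn_commute[of p q] by auto
  qed
qed

section \<open>Positive semidefiniteness of small Cauchy matrices\<close>

lemma cauchy_form2_nonneg:
  fixes x y a b :: real
  assumes "x > 0" "y > 0"
  shows "0 \<le> a\<^sup>2 / (2 * x) + b\<^sup>2 / (2 * y) + 2 * a * b / (x + y)"
proof -
  \<comment> \<open>Completing the square in \<open>a\<close> leaves \<open>b^2\<close> times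
    \<open>1/(2*y) - 2*x/(x+y)^2\<close>, which is \<open>(y-x)^2 / (2*y*(x+y)^2)\<close>.\<close>
  have "a\<^sup>2 / (2 * x) + b\<^sup>2 / (2 * y) + 2 * a * b / (x + y) =
    2 * x * (a / (2 * x) + b / (x + y))\<^sup>2 + (b * (y - x) / (y + x))\<^sup>2 / (2 * y)"
    using assms by (simp add: divide_simps add_pos_pos) algebra
  also have "\<dots> \<ge> 0" using assms by simp
  finally show ?thesis .
qed

lemma cauchy_form3_nonneg:
  fixes x y z a b c :: real
  assumes "x > 0" "y > 0" "z > 0"
  shows "0 \<le> a\<^sup>2 / (2 * x) + b\<^sup>2 / (2 * y) + c\<^sup>2 / (2 * z)
    + 2 * a * b / (x + y) + 2 * b * c / (y + z) + 2 * a * c / (x + z)"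
proof -
  \<comment> \<open>The rescaling is read off from \<open>1/(y+z) - 2*x/((x+y)*(x+z)) = (y-x)*(z-x)
    / ((x+y)*(x+z)*(y+z))\<close>.\<close>
  define b' where "b' = b * (y - x) / (y + x)"
  define c' where "c' = c * (z - x) / (z + x)"
  define A where "A = a / (2 * x)"
  define B where "B = b / (x + y)"
  define C where "C = c / (x + z)"
  note defs = b'_def c'_def A_def B_def C_def
  have nz: "x \<noteq> 0" "y \<noteq> 0" "z \<noteq> 0" "x + y \<noteq> 0" "y + z \<noteq> 0" "x + z \<noteq> 0"
    using assms by auto
  \<comment> \<open>The Schur complement of the entry \<open>1 / (2 * x)\<close> is again a Cauchy matrix, with rescaled weights.\<close>
  have 1: "b\<^sup>2 / (2 * y) = 2 * x * B\<^sup>2 + b'\<^sup>2 / (2 * y)"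
    using nz by (simp add: defs divide_simps add.commute) algebra
  have 2: "c\<^sup>2 / (2 * z) = 2 * x * C\<^sup>2 + c'\<^sup>2 / (2 * z)"
    using nz by (simp add: defs divide_simps add.commute) algebra
  have 3: "2 * b * c / (y + z) = 4 * x * B * C + 2 * b' * c' / (y + z)"
    using nz by (simp add: defs divide_simps add.commute) algebra
  have 4: "a\<^sup>2 / (2 * x) = 2 * x * A\<^sup>2"
    using nz by (simp add: defs divide_simps) algebra
  have 5: "2 * a * b / (x + y) = 4 * x * A * B" "2 * a * c / (x + z) = 4 * x * A * C"
    using nz by (simp_all add: defs)
  have "a\<^sup>2 / (2 * x) + b\<^sup>2 / (2 * y) + c\<^sup>2 / (2 * z)
      + 2 * a * b / (x + y) + 2 * b * c / (y + z) + 2 * a * c / (x + z) =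
    2 * x * (A + B + C)\<^sup>2 + (b'\<^sup>2 / (2 * y) + c'\<^sup>2 / (2 * z) + 2 * b' * c' / (y + z))"
    unfolding 1 2 3 4 5 by (simp add: power2_eq_square algebra_simps)
  also have "\<dots> \<ge> 0"
    using cauchy_form2_nonneg[of y z b' c'] assms by (intro add_nonneg_nonneg[of "2 * x * _"]) auto
  finally show ?thesis .
qed

text \<open>Right side minus left side is twice a Cauchy form: \<open>1/x\<close>,
  \<open>1/y\<close>, \<open>1/z\<close> get the coefficients \<open>s\<close>,
  \<open>2 + s + 1/s\<close>, \<open>1/s\<close>, which are the squares of \<open>sqrt s\<close>,
  \<open>sqrt s + 1 / sqrt s\<close>, \<open>1 / sqrt s\<close>.\<close>

lemma weighted_triangle_kernel:
  fixes s x y z :: real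
  assumes "s > 0" "x > 0" "y > 0" "z > 0"
  shows "1 / x + 1 / z - 4 / (x + z) \<le>
    (1 + s) * (1 / x + 1 / y - 4 / (x + y)) + (1 + 1 / s) * (1 / y + 1 / z - 4 / (y + z))"
proof -
  \<comment> \<open>The Cauchy form at the weights \<open>t\<close>, \<open>- (t + v)\<close>, \<open>v\<close>, which sum to zero.\<close>
  define t where "t = sqrt s"
  define v where "v = 1 / t"
  have t: "t > 0" "s = t\<^sup>2" using assms by (auto simp: t_def)
  have tv: "t * (t + v) = 1 + s" "(t + v) * v = 1 + 1 / s" "(t + v)\<^sup>2 = 2 + s + 1 / s"
    "t * v = 1" "v\<^sup>2 = 1 / s" "t\<^sup>2 = s"
    using t by (simp_all add: v_def field_simps power2_eq_square)
  have 1: "k / (2 * w) = k * (1 / w) / 2" for k w :: real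
    by simp
  have 2: "2 * t * (- (t + v)) / w = - (t * (t + v)) * (4 / w) / 2"
    "2 * (- (t + v)) * v / w = - ((t + v) * v) * (4 / w) / 2"
    "2 * t * v / w = (t * v) * (4 / w) / 2" for w
    by (cases "w = 0"; simp add: field_simps)+
  have "0 \<le> s * (1 / x) / 2 + (2 + s + 1 / s) * (1 / y) / 2 + (1 / s) * (1 / z) / 2
    - (1 + s) * (4 / (x + y)) / 2 - (1 + 1 / s) * (4 / (y + z)) / 2 + 4 / (x + z) / 2"
    using cauchy_form3_nonneg[OF assms(2-4), of t "- (t + v)" v]
    unfolding power2_minus 1 2 tv by linarith
  \<comment> \<open>With the reciprocals as variables, only a rearrangement linear in them
    remains.\<close>
  moreover have "X + Z - R \<le> (1 + s) * (X + Y - P) + (1 + i) * (Y + Z - Q)"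
    if "0 \<le> s * X / 2 + (2 + s + i) * Y / 2 + i * Z / 2 - (1 + s) * P / 2 - (1 + i) * Q / 2 + R / 2"
    for X Y Z P Q R i :: real
    using that by (simp add: field_simps)
  ultimately show ?thesis by blast
qed

section \<open>The weighted triangle inequality, by shifting to infinity\<close>

lemma nonneg_of_convex_vanishing_at_top:
  fixes f f' f'' :: "real \<Rightarrow> real"
  assumes f: "\<And>u. u > 0 \<Longrightarrow> (f has_real_derivative f' u) (at u)"
    and f': "\<And>u. u > 0 \<Longrightarrow> (f' has_real_derivative f'' u) (at u)"
    and f'': "\<And>u. u > 0 \<Longrightarrow> 0 \<le> f'' u"
    and lim: "(f \<longlongrightarrow> 0) at_top" "(f' \<longlongrightarrow> 0) at_top"
    and "u > 0"
  shows "0 \<le> f u"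
proof -
  \<comment> \<open>\<open>f'\<close> is nondecreasing with limit 0, hence nonpositive; then
    \<open>f\<close> is nonincreasing with limit 0, hence nonnegative.\<close>
  have f'_le: "f' v \<le> 0" if "v > 0" for v
  proof (rule tendsto_lowerbound[OF lim(2)])
    show "\<forall>\<^sub>F w in at_top. f' v \<le> f' w"
      using eventually_ge_at_top[of v]
    proof eventually_elim
      case (elim w)
      show ?case
        by (rule DERIV_nonneg_imp_nondecreasing[OF elim]) (meson f' f'' that less_le_trans)
    qed
  qed simp
  show ?thesis
  proof (rule tendsto_upperbound[OF lim(1)])
    show "\<forall>\<^sub>F w in at_top. f w \<le> f u"
      using eventually_ge_at_top[of u]
    proof eventually_elim
      case (elim w)
      show ?case
        by (rule DERIV_nonpos_imp_nonincreasing[OF elim]) (meson f f'_le \<open>u > 0\<close> less_le_trans)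
    qed
  qed simp
qed

text \<open>The derivative of \<open>jsn\<close> along the diagonal shift; the constants
  \<open>1 + 1 - 2\<close> from the product rule cancel.\<close>

definition jsn' :: "real \<Rightarrow> real \<Rightarrow> real" where
  "jsn' p q = ln p + ln q - 2 * ln (p + q) + 2 * ln 2"

lemma DERIV_jsn_shift:
  assumes "p + u > 0" "q + u > 0"
  shows "((\<lambda>u. jsn (p + u) (q + u)) has_real_derivative jsn' (p + u) (q + u)) (at u)"
proof -
  have "p + u + (q + u) > 0" using assms by linarith
  \<comment> \<open>This is \<open>w * (2 / w)\<close> with \<open>w = (p + u) + (q + u)\<close>,
    from differentiating \<open>w * ln w\<close>, in expanded form.\<close>
  moreover from this have "(4 * u + (2 * p + 2 * q)) / (2 * u + (p + q)) = 2"
    by (simp add: divide_eq_eq)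
  ultimately show ?thesis
    unfolding jsn_def jsn'_def using assms by (auto intro!: derivative_eq_intros)
qed

lemma DERIV_jsn'_shift:
  assumes "p + u > 0" "q + u > 0"
  shows "((\<lambda>u. jsn' (p + u) (q + u)) has_real_derivative
    1 / (p + u) + 1 / (q + u) - 4 / ((p + u) + (q + u))) (at u)"
proof -
  have "p + u + (q + u) > 0" using assms by linarith
  then show ?thesis
    unfolding jsn'_def using assms by (auto intro!: derivative_eq_intros)
qed

text \<open>The arguments grow while keeping their difference, so the value decays like
  \<open>(p - q)^2 / (4 * u)\<close>.\<close>

lemma tendsto_jsn_shift: "((\<lambda>u. jsn (p + u) (q + u)) \<longlongrightarrow> 0) at_top"
  unfolding jsn_def by real_asymp (simp add: field_simps)

lemma tendsto_jsn'_shift: "((\<lambda>u. jsn' (p + u) (q + u)) \<longlongrightarrow> 0) at_top"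
  unfolding jsn'_def by real_asymp

lemma jsn_weighted_triangle:
  assumes "0 \<le> p" "0 \<le> q" "0 \<le> r" "0 < s"
  shows "jsn p r \<le> (1 + s) * jsn p q + (1 + 1 / s) * jsn q r"
proof -
  define G where "G u = (1 + s) * jsn (p + u) (q + u) + (1 + 1 / s) * jsn (q + u) (r + u)
    - jsn (p + u) (r + u)" for u
  define G' where "G' u = (1 + s) * jsn' (p + u) (q + u) + (1 + 1 / s) * jsn' (q + u) (r + u)
    - jsn' (p + u) (r + u)" for u
  define G'' where "G'' u = (1 + s) * (1 / (p + u) + 1 / (q + u) - 4 / ((p + u) + (q + u)))
    + (1 + 1 / s) * (1 / (q + u) + 1 / (r + u) - 4 / ((q + u) + (r + u)))
    - (1 / (p + u) + 1 / (r + u) - 4 / ((p + u) + (r + u)))" for u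
  have pos: "0 \<le> G u" if "u > 0" for u
  proof (rule nonneg_of_convex_vanishing_at_top[of G G' G''])
    fix u :: real assume "u > 0"
    then have u: "p + u > 0" "q + u > 0" "r + u > 0" using assms by auto
    show "(G has_real_derivative G' u) (at u)"
      unfolding G_def G'_def
      by (intro DERIV_diff DERIV_add DERIV_cmult DERIV_jsn_shift u)
    show "(G' has_real_derivative G'' u) (at u)"
      unfolding G'_def G''_def
      by (intro DERIV_diff DERIV_add DERIV_cmult DERIV_jsn'_shift u)
    show "0 \<le> G'' u"
      using weighted_triangle_kernel[OF \<open>0 < s\<close> u] unfolding G''_def by linarith
  next
    show "(G \<longlongrightarrow> 0) at_top"
      unfolding G_def by (rule tendsto_eq_intros tendsto_jsn_shift refl | simp)+
    show "(G' \<longlongrightarrow> 0) at_top"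
      unfolding G'_def by (rule tendsto_eq_intros tendsto_jsn'_shift refl | simp)+
  qed fact
  \<comment> \<open>The derivatives may fail at \<open>u = 0\<close>, where arguments can vanish, so
    \<open>u = 0\<close> is reached as a limit from the right.\<close>
  have "continuous_on {0..} G"
    unfolding G_def using assms by (intro continuous_intros) auto
  then have "(G \<longlongrightarrow> G 0) (at 0 within {0..})"
    by (simp add: continuous_on_def)
  then have "(G \<longlongrightarrow> G 0) (at_right 0)"
    by (simp add: at_within_Ici_at_right)
  then have "0 \<le> G 0"
    by (rule tendsto_lowerbound) (auto intro!: eventually_at_rightI[of 0 1] pos)
  then show ?thesis by (simp add: G_def)
qed

text \<open>The infimum of the bound over \<open>s > 0\<close> is
  \<open>(sqrt A + sqrt B)^2\<close>. For \<open>A = 0\<close> it is approached as \<open>s\<close>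
  tends to infinity, for \<open>B = 0\<close> as \<open>s\<close> tends to 0.\<close>

lemma sqrt_triangle_of_weighted:
  fixes A B C :: real
  assumes "0 \<le> A" "0 \<le> B" and C: "\<And>s. 0 < s \<Longrightarrow> C \<le> (1 + s) * A + (1 + 1 / s) * B"
  shows "sqrt C \<le> sqrt A + sqrt B"
proof -
  consider "A = 0" | "B = 0" | "A > 0" "B > 0" using assms by linarith
  then show ?thesis
  proof cases
    case 1
    have "((\<lambda>s. (1 + 1 / s) * B) \<longlongrightarrow> B) at_top" by real_asymp
    then have "C \<le> B"
      by (rule tendsto_lowerbound) (use C 1 in \<open>auto intro!: eventually_mono[OF eventually_gt_at_top[of 0]]\<close>)
    then show ?thesis using 1 by simp
  next
    case 2
    have "((\<lambda>s. (1 + s) * A) \<longlongrightarrow> A) (at_right 0)" by real_asymp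
    then have "C \<le> A"
      by (rule tendsto_lowerbound) (use C 2 in \<open>auto intro!: eventually_at_rightI[of 0 1]\<close>)
    then show ?thesis using 2 by simp
  next
    case 3
    \<comment> \<open>\<open>s = sqrt B / sqrt A\<close> is the minimiser: there
      \<open>s * A\<close> and \<open>B / s\<close> both equal
      \<open>sqrt A * sqrt B\<close>.\<close>
    have "(1 + sqrt B / sqrt A) * (sqrt A)\<^sup>2 + (1 + 1 / (sqrt B / sqrt A)) * (sqrt B)\<^sup>2
        = (sqrt A + sqrt B)\<^sup>2"
      using 3 by (simp add: field_simps power2_eq_square del: real_sqrt_mult_self)
    then have "C \<le> (sqrt A + sqrt B)\<^sup>2"
      using C[of "sqrt B / sqrt A"] 3 by simp
    then show ?thesis using assms by (intro real_le_lsqrt) auto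
  qed
qed

section \<open>Transfer to intuitionistic fuzzy values\<close>

lemma ifv_bounds:
  "0 \<le> membership a" "membership a \<le> 1" "0 \<le> nonmembership a" "nonmembership a \<le> 1"
  "membership a + nonmembership a \<le> 1"
  using pair_of_ifv[of a] by (auto simp: membership_def nonmembership_def)

lemma ifv_eq_iff: "a = b \<longleftrightarrow> membership a = membership b \<and> nonmembership a = nonmembership b"
  by (simp add: membership_def nonmembership_def flip: pair_of_ifv_inject prod_eq_iff)

lemma eq_Ifv_iff:
  assumes "0 \<le> m" "m \<le> 1" "0 \<le> n" "n \<le> 1" "m + n \<le> 1"
  shows "a = Ifv (m, n) \<longleftrightarrow> membership a = m \<and> nonmembership a = n"
  using assms by (simp add: ifv_eq_iff membership_def nonmembership_def Ifv_inverse)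

definition JS_sum :: "ifv \<Rightarrow> ifv \<Rightarrow> real" where
  "JS_sum a b = jsn (1 - membership a) (1 - membership b) + jsn (nonmembership a) (nonmembership b)"

lemma JS_IF_eq: "JS_IF a b = sqrt (JS_sum a b / (2 * ln 2))"
  using ifv_bounds[of a] ifv_bounds[of b]
  by (simp add: JS_IF_def JS_sum_def JS_term_eq_jsn add_divide_distrib mult.commute)

lemma JS_sum_nonneg: "0 \<le> JS_sum a b"
  using ifv_bounds[of a] ifv_bounds[of b] by (simp add: JS_sum_def jsn_nonneg)

lemma JS_sum_le: "JS_sum a b \<le> 2 * ln 2"
  using ifv_bounds[of a] ifv_bounds[of b]
    jsn_le_ln2[of "1 - membership a" "1 - membership b"] jsn_le_ln2[of "nonmembership a" "nonmembership b"]
  by (simp add: JS_sum_def)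

lemma JS_sum_commute: "JS_sum a b = JS_sum b a"
  by (simp add: JS_sum_def jsn_commute)

lemma JS_sum_eq_0_iff: "JS_sum a b = 0 \<longleftrightarrow> a = b"
proof
  assume "JS_sum a b = 0"
  then have "jsn (1 - membership a) (1 - membership b) = 0" "jsn (nonmembership a) (nonmembership b) = 0"
    using jsn_nonneg[of "1 - membership a" "1 - membership b"]
      jsn_nonneg[of "nonmembership a" "nonmembership b"] ifv_bounds[of a] ifv_bounds[of b]
    by (simp_all add: JS_sum_def)
  then show "a = b"
    using jsn_pos[of "1 - membership a" "1 - membership b"]
      jsn_pos[of "nonmembership a" "nonmembership b"] ifv_bounds[of a] ifv_bounds[of b]
    by (force simp: ifv_eq_iff)
qed (use ifv_bounds[of a] in \<open>simp add: JS_sum_def\<close>)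

text \<open>Each summand is at most \<open>ln 2\<close>, so both are maximal. Of the four resulting
  endpoint combinations, two would contain the pair \<open>(1, 1)\<close>, which violates the bound
  on the sum of the coordinates.\<close>

lemma JS_sum_eq_max_iff:
  "JS_sum a b = 2 * ln 2 \<longleftrightarrow> a = Ifv (0, 1) \<and> b = Ifv (1, 0) \<or> a = Ifv (1, 0) \<and> b = Ifv (0, 1)"
proof -
  have "JS_sum a b = 2 * ln 2 \<longleftrightarrow>
      jsn (1 - membership a) (1 - membership b) = ln 2 \<and> jsn (nonmembership a) (nonmembership b) = ln 2"
    using ifv_bounds[of a] ifv_bounds[of b] jsn_le_ln2[of "1 - membership a" "1 - membership b"]
      jsn_le_ln2[of "nonmembership a" "nonmembership b"]
    by (auto simp: JS_sum_def)
  then show ?thesis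
    using ifv_bounds[of a] ifv_bounds[of b] by (auto simp: jsn_eq_ln2_iff eq_Ifv_iff)
qed

text \<open>Both \<open>1 - membership\<close> and \<open>nonmembership\<close> reverse
  \<open>ifv_subset\<close>, so the intervals nest in both components, strictly in at least
  one.\<close>

lemma JS_sum_strict_mono:
  assumes "ifv_subset a' a" "ifv_subset a b" "ifv_subset b b'" "a' \<noteq> a \<or> b \<noteq> b'"
  shows "JS_sum a b < JS_sum a' b'"
proof -
  let ?m = membership and ?n = nonmembership
  have le: "1 - ?m b' \<le> 1 - ?m b" "1 - ?m b \<le> 1 - ?m a" "1 - ?m a \<le> 1 - ?m a'"
    "?n b' \<le> ?n b" "?n b \<le> ?n a" "?n a \<le> ?n a'" "0 \<le> 1 - ?m b'" "0 \<le> ?n b'"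
    using assms(1-3) ifv_bounds[of b'] by (simp_all add: ifv_subset_def)
  have "(1 - ?m b' \<noteq> 1 - ?m b \<or> 1 - ?m a \<noteq> 1 - ?m a') \<or> (?n b' \<noteq> ?n b \<or> ?n a \<noteq> ?n a')"
    using assms(4) by (auto simp: ifv_eq_iff)
  \<comment> \<open>The arguments are swapped because the reversed order puts \<open>b\<close> and
    \<open>b'\<close> at the lower ends.\<close>
  then have "JS_sum b a < JS_sum b' a'"
  proof
    assume "1 - ?m b' \<noteq> 1 - ?m b \<or> 1 - ?m a \<noteq> 1 - ?m a'"
    then show ?thesis unfolding JS_sum_def
      by (intro add_less_le_mono jsn_strict_mono jsn_mono le)
  next
    assume "?n b' \<noteq> ?n b \<or> ?n a \<noteq> ?n a'"
    then show ?thesis unfolding JS_sum_def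
      by (intro add_le_less_mono jsn_strict_mono jsn_mono le)
  qed
  then show ?thesis by (simp add: JS_sum_commute)
qed

lemma JS_IF_triangle: "JS_IF a c \<le> JS_IF a b + JS_IF b c"
  unfolding JS_IF_eq
proof (rule sqrt_triangle_of_weighted)
  fix s :: real assume s: "0 < s"
  \<comment> \<open>The same \<open>s\<close> serves both components, so the two inequalities add
    up.\<close>
  have "JS_sum a c \<le> (1 + s) * JS_sum a b + (1 + 1 / s) * JS_sum b c"
    using jsn_weighted_triangle[of "1 - membership a" "1 - membership b" "1 - membership c" s]
      jsn_weighted_triangle[of "nonmembership a" "nonmembership b" "nonmembership c" s]
      ifv_bounds[of a] ifv_bounds[of b] ifv_bounds[of c] s
    by (simp add: JS_sum_def distrib_left)
  then have "JS_sum a c / (2 * ln 2) \<le> ((1 + s) * JS_sum a b + (1 + 1 / s) * JS_sum b c) / (2 * ln 2)"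
    by (rule divide_right_mono) simp
  then show "JS_sum a c / (2 * ln 2) \<le>
      (1 + s) * (JS_sum a b / (2 * ln 2)) + (1 + 1 / s) * (JS_sum b c / (2 * ln 2))"
    by (simp only: add_divide_distrib times_divide_eq_right)
qed (simp_all add: JS_sum_nonneg)

section \<open>Axioms of the distance and similarity measures\<close>

lemma JS_IF_bounds: "JS_IF a b \<in> {0..1}"
  using JS_sum_nonneg[of a b] JS_sum_le[of a b] by (simp add: JS_IF_eq)

lemma JS_IF_commute: "JS_IF a b = JS_IF b a"
  by (simp add: JS_IF_eq JS_sum_commute)

lemma JS_IF_eq_0_iff: "JS_IF a b = 0 \<longleftrightarrow> a = b"
  by (simp add: JS_IF_eq JS_sum_eq_0_iff)

lemma JS_IF_eq_1_iff:
  "JS_IF a b = 1 \<longleftrightarrow> a = Ifv (0, 1) \<and> b = Ifv (1, 0) \<or> a = Ifv (1, 0) \<and> b = Ifv (0, 1)"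
  by (auto simp add: JS_IF_eq simp flip: JS_sum_eq_max_iff)

lemma JS_IF_strict_mono:
  assumes "ifv_psubset a b" "ifv_psubset b c"
  shows "JS_IF a b < JS_IF a c" "JS_IF b c < JS_IF a c"
proof -
  have "ifv_subset x x" for x by (simp add: ifv_subset_def)
  \<comment> \<open>One end stays fixed while the other moves strictly.\<close>
  then have "JS_sum a b < JS_sum a c" "JS_sum b c < JS_sum a c"
    using assms JS_sum_strict_mono[of a a b c] JS_sum_strict_mono[of a b c c]
    by (auto simp: ifv_psubset_def)
  then show "JS_IF a b < JS_IF a c" "JS_IF b c < JS_IF a c"
    by (simp_all add: JS_IF_eq divide_strict_right_mono)
qed

lemma SIFSimM_S_IF: "SIFSimM S_IF"
  unfolding SIFSimM_def S_IF_def
  using JS_IF_bounds JS_IF_strict_mono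
  by (simp add: JS_IF_commute JS_IF_eq_0_iff JS_IF_eq_1_iff[symmetric])

theorem theorem1:
  shows "SIFDisM JS_IF \<and> SIFSimM S_IF"
proof
  have "Metric_space UNIV JS_IF"
    by unfold_locales (use JS_IF_bounds JS_IF_commute JS_IF_eq_0_iff in \<open>auto intro: JS_IF_triangle\<close>)
  moreover have "SIFSimM (\<lambda>a b. 1 - JS_IF a b)"
    using SIFSimM_S_IF by (simp add: S_IF_def[abs_def])
  ultimately show "SIFDisM JS_IF"
    using JS_IF_bounds by (simp add: SIFDisM_def)
qed (fact SIFSimM_S_IF)

end
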